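(* Let $U$ be a region in the complex plane containing $D(0,1+\delta)$ for some $\delta>0$, and let $f$ be a bounded analytic function on $U$ such that $f(z)\ne0$ whenever $|z|=1$. Let $n$ be the number of zeros of $f$ in $\{|z|<1\}$, counted with multiplicity. Let $a_r$ ($r=0,\dots,N-n-1$) be the points $a_r=\rho(s_r)^{1/N}e^{is_r}$ defined in the context for all large enough $N$. Then given $\alpha\in(1,2)$ there exists a constant $b$ such that for all large enough $N$ and every $r\in\{0,\dots,N-n-1\}$ the equation $z^N=f(z)$ has a solution $z_r$ satisfying $$|z_r-a_r|\le bN^{-\alpha}.$$ Moreover, to leading order the $N-n$ solutions of $z^N=f(z)$ that are close to the unit circle are uniformly distributed around it, i.e. for all $0\le\theta_1<\theta_2\le2\pi$ the proportion of these $N-n$ solutions with argument in $(\theta_1,\theta_2)$ converges to $(\theta_2-\theta_1)/(2\pi)$ as $N\to\infty$.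
   Context: $D(w,r)=\{z\in\mathbf{C}:|z-w|\le r\}$. Write $f(e^{is})=\rho(s)e^{i\phi(s)}$ for $s\in[0,2\pi]$, where $\rho>0$ and $\phi$ are real analytic functions of $s$, $\rho$ is periodic and $\phi(2\pi)=\phi(0)+2\pi n$. For all large enough $N$ the equation $\phi(s)=Ns \pmod{2\pi}$ has exactly $N-n$ solutions in $[0,2\pi)$; label them in increasing order as $s_0<s_1<\dots<s_{N-n-1}$, and put $a_r:=\rho(s_r)^{1/N}e^{is_r}$. The $N-n$ solutions close to the unit circle are those which, for any fixed sufficiently small $\varepsilon>0$ and all large enough $N$, lie in $\{z:1-\varepsilon<|z|<1+\varepsilon\}$ (there are exactly $N-n$ of these); arguments are taken in $[0,2\pi)$. *)

theory Defs
  imports "HOL-Complex_Analysis.Complex_Analysis" "HOL-Library.Real_Mod"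
begin

text \<open>
  The power series is only required to represent \<open>g\<close> on \<open>S\<close> itself, so at an endpoint of a
  closed interval the expansion is one-sided.
\<close>
definition real_analytic_on :: "(real \<Rightarrow> real) \<Rightarrow> real set \<Rightarrow> bool"
  (infixl "real'_analytic'_on" 50) where
  "g real_analytic_on S \<longleftrightarrow>
     (\<forall>x\<in>S. \<exists>e>0. \<exists>a :: nat \<Rightarrow> real. \<forall>y\<in>S. \<bar>y - x\<bar> < e \<longrightarrow> (\<lambda>k. a k * (y - x) ^ k) sums g y)"

text \<open>
  \<open>\<rho>(2\<pi>) = \<rho>(0)\<close> and \<open>\<phi>(2\<pi>) = \<phi>(0) + 2\<pi>n\<close> are not required here: the first holds because
  \<open>\<rho>(s) = |f(e\<^sup>i\<^sup>s)|\<close>, the second by the argument principle.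
\<close>
definition polar_form :: "(complex \<Rightarrow> complex) \<Rightarrow> (real \<Rightarrow> real) \<Rightarrow> (real \<Rightarrow> real) \<Rightarrow> bool" where
  "polar_form f \<rho> \<phi> \<longleftrightarrow>
     \<rho> real_analytic_on {0..2*pi} \<and> \<phi> real_analytic_on {0..2*pi} \<and>
     (\<forall>s\<in>{0..2*pi}. \<rho> s > 0 \<and> f (cis s) = of_real (\<rho> s) * cis (\<phi> s))"

text \<open>A finite sum whenever \<open>f\<close> is holomorphic near the closed unit disc and nonzero on its boundary.\<close>
definition zeros_in_disc :: "(complex \<Rightarrow> complex) \<Rightarrow> nat" where
  "zeros_in_disc f = (\<Sum>z | norm z < 1 \<and> f z = 0. nat (zorder f z))"

definition phase_set :: "(real \<Rightarrow> real) \<Rightarrow> nat \<Rightarrow> real set" where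
  "phase_set \<phi> N = {s \<in> {0..<2*pi}. [\<phi> s = real N * s] (rmod (2*pi))}"

text \<open>Meaningful when \<open>phase_set \<phi> N\<close> is finite with more than \<open>r\<close> elements.\<close>
definition phase :: "(real \<Rightarrow> real) \<Rightarrow> nat \<Rightarrow> nat \<Rightarrow> real" where
  "phase \<phi> N r = sorted_list_of_set (phase_set \<phi> N) ! r"

definition approx_sol :: "(real \<Rightarrow> real) \<Rightarrow> (real \<Rightarrow> real) \<Rightarrow> nat \<Rightarrow> nat \<Rightarrow> complex" where
  "approx_sol \<rho> \<phi> N r =
     of_real (\<rho> (phase \<phi> N r) powr (1 / real N)) * cis (phase \<phi> N r)"

definition solutions_near_circle ::
    "complex set \<Rightarrow> (complex \<Rightarrow> complex) \<Rightarrow> real \<Rightarrow> nat \<Rightarrow> complex set" where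
  "solutions_near_circle U f \<epsilon> N = {z \<in> U. z ^ N = f z \<and> 1 - \<epsilon> < norm z \<and> norm z < 1 + \<epsilon>}"

end

theory Submission
  imports Defs
begin

text \<open>
  The substitution \<open>z = e\<^sup>w\<close> turns \<open>z\<^sup>N = f z\<close> into an almost linear equation. On a narrow
  strip about the imaginary axis \<open>f \<circ> exp\<close> has no zeros, so it has a holomorphic logarithm, and by the
  argument principle this logarithm grows by \<open>2\<pi>\<i>n\<close> when \<open>w\<close> moves up by \<open>2\<pi>\<i>\<close>. Hence
  \<open>f (e\<^sup>w) = exp (n w + p w)\<close> where \<open>p\<close> has period \<open>2\<pi>\<i>\<close>, and by periodicity \<open>p\<close> and its derivative
  are bounded on a slightly smaller closed strip (\<open>periodic_logarithm\<close>). With \<open>P = N - n\<close> the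
  equation becomes \<open>P w = p w + 2\<pi>\<i>k\<close> for some integer \<open>k\<close>.

  For large \<open>P\<close> the map \<open>w \<mapsto> (p w + 2\<pi>\<i>k) / P\<close> is a contraction of the closed strip, so each \<open>k\<close>
  contributes exactly one root \<open>w\<^sub>k\<close>. Periodicity gives \<open>w\<^bsub>k+P\<^esub> = w\<^sub>k + 2\<pi>\<i>\<close>, so the roots
  represent exactly \<open>P\<close> different solutions \<open>z\<close>; and boundedness gives
  \<open>w\<^sub>k = 2\<pi>\<i>k/P + O(1/P)\<close>, so their arguments form an arithmetic progression up to a bounded
  number of steps and are uniformly distributed
  (\<open>card_fundamental_roots\<close>, \<open>card_fundamental_roots_window\<close>).

  The phases \<open>s\<^sub>r\<close> are roots of the same kind. Indeed \<open>\<phi>(s) \<equiv> n s + Im p(\<i>s)\<close> modulo \<open>2\<pi>\<close>, so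
  \<open>\<i>s\<close> solves \<open>P w = q w + 2\<pi>\<i>k\<close> with \<open>q w = \<i> Im p(\<i> Im w)\<close>, and \<open>q\<close> is again periodic, bounded
  and Lipschitz; so the same count gives \<open>N - n\<close> phases (\<open>card_phase_set\<close>). Finally, \<open>a\<^sub>r\<close> is \<open>exp\<close> of the
  point obtained from \<open>\<i>s\<^sub>r\<close> by one step of the iteration \<open>w \<mapsto> (n w + p w + 2\<pi>\<i>k) / N\<close>.
  The contraction constant is \<open>O(1/N)\<close> and the step has length \<open>O(1/N)\<close>, so the fixed point lies
  within \<open>O(1/N\<^sup>2)\<close> of it (\<open>root_near_first_iterate\<close>), which is enough for every exponent
  \<open>\<alpha> \<le> 2\<close>.
\<close>

section \<open>Counting quasi-periodic sequences of reals\<close>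

lemma card_integers_between:
  fixes u v :: real
  shows "finite {k::int. u < k \<and> k < v}"
    and "v - u - 1 \<le> real (card {k::int. u < k \<and> k < v})"
    and "u \<le> v \<Longrightarrow> real (card {k::int. u < k \<and> k < v}) \<le> v - u + 1"
proof -
  have eq: "{k::int. u < k \<and> k < v} = {\<lfloor>u\<rfloor> + 1..\<lceil>v\<rceil> - 1}"
    by (auto simp: floor_less_iff less_ceiling_iff) linarith+
  show "finite {k::int. u < k \<and> k < v}"
    by (simp add: eq)
  show "v - u - 1 \<le> real (card {k::int. u < k \<and> k < v})"
    unfolding eq card_atLeastAtMost_int by linarith
  show "real (card {k::int. u < k \<and> k < v}) \<le> v - u + 1" if "u \<le> v"
    using that unfolding eq card_atLeastAtMost_int by linarith
qed

text \<open>
  The error bound does not depend on \<open>P\<close>: multiplied by \<open>P / (2 * pi)\<close>, the perturbation moves both ends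
  of the window by at most \<open>B / (2 * pi)\<close>, which can change the count by at most \<open>B / pi\<close> beyond rounding.
\<close>
lemma card_window_of_perturbed_progression:
  fixes x :: "int \<Rightarrow> real" and P :: nat and B a b :: real
  assumes P: "P > 0" and ab: "a \<le> b"
    and near: "\<And>k. \<bar>x k - 2 * pi * k / P\<bar> \<le> B / P"
  shows "\<bar>real (card {k. a < x k \<and> x k < b}) - P * (b - a) / (2 * pi)\<bar> \<le> B / pi + 1"
proof -
  define T where "T = {k. a < x k \<and> x k < b}"
  define lo where "lo = {k::int. (P * a + B) / (2 * pi) < k \<and> k < (P * b - B) / (2 * pi)}"
  define hi where "hi = {k::int. (P * a - B) / (2 * pi) < k \<and> k < (P * b + B) / (2 * pi)}"
  have near': "\<bar>P * x k - 2 * pi * k\<bar> \<le> B" for k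
  proof -
    have "P * \<bar>x k - 2 * pi * k / P\<bar> \<le> P * (B / P)"
      using near[of k] by (intro mult_left_mono) auto
    moreover have "P * \<bar>x k - 2 * pi * k / P\<bar> = \<bar>P * (x k - 2 * pi * k / P)\<bar>"
      by (simp add: abs_mult)
    moreover have "P * (x k - 2 * pi * k / P) = P * x k - 2 * pi * k"
      using P by (simp add: field_simps)
    ultimately show ?thesis
      using P by simp
  qed
  have B: "B \<ge> 0"
    using near'[of 0] by linarith
  have scale: "a < x k \<longleftrightarrow> P * a < P * x k" "x k < b \<longleftrightarrow> P * x k < P * b" for k
    using P by auto
  have "lo \<subseteq> T"
  proof
    fix k assume "k \<in> lo"
    then have "P * a + B < 2 * pi * k" "2 * pi * k < P * b - B"
      by (auto simp: lo_def field_simps)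
    then show "k \<in> T"
      using near'[of k] unfolding T_def mem_Collect_eq scale by linarith
  qed
  have "T \<subseteq> hi"
  proof
    fix k assume "k \<in> T"
    then have "P * a - B < 2 * pi * k" "2 * pi * k < P * b + B"
      using near'[of k] unfolding T_def mem_Collect_eq scale by linarith+
    then show "k \<in> hi"
      by (auto simp: hi_def field_simps)
  qed
  have hi_le: "(P * a - B) / (2 * pi) \<le> (P * b + B) / (2 * pi)"
    using mult_left_mono[OF ab, of "real P"] B by (intro divide_right_mono) auto
  have fin: "finite hi"
    unfolding hi_def by (rule card_integers_between)
  have "real (card lo) \<le> card T" "real (card T) \<le> card hi"
    using \<open>lo \<subseteq> T\<close> \<open>T \<subseteq> hi\<close> fin by (auto intro!: card_mono finite_subset[OF \<open>T \<subseteq> hi\<close>])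
  moreover have "(P * b - B) / (2 * pi) - (P * a + B) / (2 * pi) - 1 \<le> card lo"
    unfolding lo_def by (rule card_integers_between)
  moreover have "card hi \<le> (P * b + B) / (2 * pi) - (P * a - B) / (2 * pi) + 1"
    unfolding hi_def using hi_le by (rule card_integers_between)
  moreover have "(P * b - B) / (2 * pi) - (P * a + B) / (2 * pi) = P * (b - a) / (2 * pi) - B / pi"
    "(P * b + B) / (2 * pi) - (P * a - B) / (2 * pi) = P * (b - a) / (2 * pi) + B / pi"
    by (simp_all add: field_simps)
  ultimately show "\<bar>real (card {k. a < x k \<and> x k < b}) - P * (b - a) / (2 * pi)\<bar> \<le> B / pi + 1"
    unfolding T_def by linarith
qed

text \<open>
  Reduction modulo \<open>P\<close> is a bijection from the indices in the window to the residues: shifting an index by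
  \<open>P\<close> shifts its value by exactly the length \<open>c\<close> of the window.
\<close>
lemma card_period_window:
  fixes x :: "int \<Rightarrow> real" and P :: nat and c :: real
  assumes P: "P > 0" and c: "c > 0"
    and shift: "\<And>k j. x (k + j * int P) = x k + c * j"
  shows "finite {k. 0 \<le> x k \<and> x k < c}" and "card {k. 0 \<le> x k \<and> x k < c} = P"
proof -
  have bij: "bij_betw (\<lambda>k. k mod int P) {k. 0 \<le> x k \<and> x k < c} {0..<int P}"
    unfolding bij_betw_def
  proof
    show "inj_on (\<lambda>k. k mod int P) {k. 0 \<le> x k \<and> x k < c}"
    proof (rule inj_onI)
      fix k l assume k: "k \<in> {k. 0 \<le> x k \<and> x k < c}" and l: "l \<in> {k. 0 \<le> x k \<and> x k < c}"
        and "k mod int P = l mod int P"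
      then obtain j where j: "k = l + j * int P"
        by (metis mod_eqE mult.commute add_diff_cancel_left' diff_add_cancel)
      have "\<bar>c * j\<bar> < c * 1"
        using k l shift[of l j] by (auto simp: j)
      then have "\<bar>real_of_int j\<bar> < 1"
        using c by (simp add: abs_mult)
      then have "j = 0"
        by linarith
      then show "k = l"
        by (simp add: j)
    qed
    show "(\<lambda>k. k mod int P) ` {k. 0 \<le> x k \<and> x k < c} = {0..<int P}"
    proof (intro subset_antisym subsetI)
      fix r assume r: "r \<in> {0..<int P}"
      \<comment> \<open>with this \<open>j\<close>, the translate \<open>x r + c * j\<close> falls into \<open>{0..<c}\<close>\<close>
      define j where "j = - \<lfloor>x r / c\<rfloor>"
      have "x (r + j * int P) = c * (x r / c - \<lfloor>x r / c\<rfloor>)"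
        unfolding shift using c by (simp add: j_def field_simps)
      moreover have "0 \<le> x r / c - \<lfloor>x r / c\<rfloor>" "x r / c - \<lfloor>x r / c\<rfloor> < 1"
        by linarith+
      ultimately have "0 \<le> x (r + j * int P)" "x (r + j * int P) < c"
        using c by (simp_all add: mult_less_cancel_left2 del: mult_le_cancel_left1)
      then show "r \<in> (\<lambda>k. k mod int P) ` {k. 0 \<le> x k \<and> x k < c}"
        using r by (intro image_eqI[of _ _ "r + j * int P"]) auto
    qed (use P in auto)
  qed
  show "finite {k. 0 \<le> x k \<and> x k < c}"
    using bij_betw_finite[OF bij] by simp
  show "card {k. 0 \<le> x k \<and> x k < c} = P"
    using bij_betw_same_card[OF bij] by simp
qed

section \<open>Periodic Lipschitz perturbations on a strip\<close>

definition strip :: "real \<Rightarrow> complex set" where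
  "strip \<eta> = {w. \<bar>Re w\<bar> \<le> \<eta>}"

lemma strip_add_imaginary [simp]: "Re v = 0 \<Longrightarrow> w + v \<in> strip \<eta> \<longleftrightarrow> w \<in> strip \<eta>"
  by (simp add: strip_def)

lemma closed_strip: "closed (strip \<eta>)"
proof -
  have "strip \<eta> = Re -` {-\<eta>..\<eta>}"
    by (auto simp: strip_def)
  then show ?thesis
    by (auto intro!: closed_vimage continuous_intros)
qed

lemma convex_strip: "convex (strip \<eta>)"
proof -
  have "strip \<eta> = Re -` {-\<eta>..\<eta>}"
    by (auto simp: strip_def)
  then show ?thesis
    by (auto intro!: convex_linear_vimage linearI)
qed

lemma open_strip_topology:
  fixes \<eta> :: real
  shows "open {w. \<bar>Re w\<bar> < \<eta>}" and "convex {w. \<bar>Re w\<bar> < \<eta>}"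
proof -
  have "{w. \<bar>Re w\<bar> < \<eta>} = Re -` {-\<eta><..<\<eta>}"
    by auto
  then show "open {w. \<bar>Re w\<bar> < \<eta>}" "convex {w. \<bar>Re w\<bar> < \<eta>}"
    by (auto intro!: convex_linear_vimage linearI open_vimage continuous_intros)
qed

lemma periodic_int_shift:
  assumes "\<And>w. w \<in> strip \<eta> \<Longrightarrow> p (w + 2 * pi * \<i>) = p w" and "w \<in> strip \<eta>"
  shows "p (w + 2 * pi * \<i> * of_int j) = p w"
proof (induction j rule: int_induct[of _ 0])
  case (step1 j)
  have "p (w + 2 * pi * \<i> * of_int (j + 1)) = p ((w + 2 * pi * \<i> * of_int j) + 2 * pi * \<i>)"
    by (simp add: algebra_simps)
  also have "\<dots> = p w"
    by (subst assms(1)) (use step1 assms(2) in auto)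
  finally show ?case .
next
  case (step2 j)
  have "p (w + 2 * pi * \<i> * of_int (j - 1)) = p ((w + 2 * pi * \<i> * of_int (j - 1)) + 2 * pi * \<i>)"
    by (subst assms(1)) (use assms(2) in auto)
  also have "\<dots> = p w"
    using step2 by (simp add: algebra_simps)
  finally show ?case .
qed simp

text \<open>
  By periodicity the values on the strip are those on one period, which is a compact rectangle.
\<close>
lemma periodic_continuous_bounded:
  fixes p :: "complex \<Rightarrow> complex"
  assumes per: "\<And>w. w \<in> strip \<eta> \<Longrightarrow> p (w + 2 * pi * \<i>) = p w"
    and cont: "continuous_on (strip \<eta>) p"
  shows "\<exists>B. \<forall>w\<in>strip \<eta>. norm (p w) \<le> B"
proof -
  let ?K = "cbox (Complex (-\<eta>) 0) (Complex \<eta> (2 * pi))"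
  have K: "?K \<subseteq> strip \<eta>"
    by (auto simp: strip_def in_cbox_complex_iff)
  have "bounded (p ` ?K)"
    using cont K by (intro compact_imp_bounded compact_continuous_image)
      (auto intro: continuous_on_subset)
  then obtain B where B: "norm (p w) \<le> B" if "w \<in> ?K" for w
    by (auto simp: bounded_iff)
  have "norm (p w) \<le> B" if w: "w \<in> strip \<eta>" for w
  proof -
    define j where "j = - \<lfloor>Im w / (2 * pi)\<rfloor>"
    define v where "v = w + 2 * pi * \<i> * of_int j"
    have "Im v = 2 * pi * (Im w / (2 * pi) - \<lfloor>Im w / (2 * pi)\<rfloor>)"
      by (simp add: v_def j_def field_simps)
    moreover have "0 \<le> Im w / (2 * pi) - \<lfloor>Im w / (2 * pi)\<rfloor>" "Im w / (2 * pi) - \<lfloor>Im w / (2 * pi)\<rfloor> \<le> 1"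
      by linarith+
    ultimately have "0 \<le> Im v" "Im v \<le> 2 * pi"
      by (simp_all add: mult_le_cancel_left1)
    then have "v \<in> ?K"
      using w by (auto simp: in_cbox_complex_iff v_def strip_def)
    moreover have "p v = p w"
      unfolding v_def using per w by (rule periodic_int_shift)
    ultimately show ?thesis
      using B by metis
  qed
  then show ?thesis by blast
qed

text \<open>
  These properties of \<open>p\<close> give the count of the roots. They are stated without holomorphy so that the
  count also applies to the non-holomorphic function whose roots are the phases.
\<close>
locale periodic_perturbation =
  fixes p :: "complex \<Rightarrow> complex" and \<eta> B L :: real
  assumes \<eta>_pos: "\<eta> > 0"
    and periodic: "\<And>w. w \<in> strip \<eta> \<Longrightarrow> p (w + 2 * pi * \<i>) = p w"
    and bound: "\<And>w. w \<in> strip \<eta> \<Longrightarrow> norm (p w) \<le> B"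
    and lipschitz: "\<And>v w. \<lbrakk>v \<in> strip \<eta>; w \<in> strip \<eta>\<rbrakk> \<Longrightarrow> norm (p v - p w) \<le> L * norm (v - w)"
begin

text \<open>
  Such a \<open>w\<close> exists and is unique when \<open>P > L\<close> and \<open>P \<ge> B / \<eta>\<close>.
\<close>
definition root :: "nat \<Rightarrow> int \<Rightarrow> complex" where
  "root P k = (THE w. w \<in> strip \<eta> \<and> of_nat P * w = p w + 2 * pi * \<i> * of_int k)"

text \<open>
  The roots in one period strip, one for each solution \<open>z = exp w\<close>. The exponential form of the
  equation says that some integer \<open>k\<close> makes \<open>w\<close> the root with index \<open>k\<close>.
\<close>
definition fundamental_roots :: "nat \<Rightarrow> complex set" where
  "fundamental_roots P = {w \<in> strip \<eta>. 0 \<le> Im w \<and> Im w < 2 * pi \<and> exp (of_nat P * w) = exp (p w)}"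

lemma zero_in_strip: "0 \<in> strip \<eta>"
  using \<eta>_pos by (simp add: strip_def)

lemma L_nonneg: "0 \<le> L"
proof -
  have "0 \<le> L * norm (1 * \<eta> - 0 :: complex)"
    using lipschitz[of "1 * \<eta>" 0] \<eta>_pos
    by (intro order.trans[OF norm_ge_zero]) (auto simp: strip_def)
  then show ?thesis
    using \<eta>_pos by (simp add: zero_le_mult_iff)
qed

lemma B_nonneg: "0 \<le> B"
  using bound[OF zero_in_strip] norm_ge_zero order.trans by blast

lemma eventually_large: "\<forall>\<^sub>F P in sequentially. L < real P \<and> B \<le> \<eta> * real P"
proof -
  have "\<forall>\<^sub>F P in sequentially. max (L + 1) (B / \<eta>) \<le> real P"
    using filterlim_real_sequentially unfolding filterlim_at_top by blast
  then show ?thesis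
    by eventually_elim (use \<eta>_pos in \<open>auto simp: field_simps\<close>)
qed

context
  fixes P :: nat
  assumes large: "L < real P" "B \<le> \<eta> * real P"
begin

lemma P_pos: "P > 0"
  using L_nonneg large by (cases P) auto

text \<open>
  The two largeness conditions are those of the contraction principle: \<open>L < P\<close> makes
  \<open>w \<mapsto> (p w + 2\<pi>\<i>k) / P\<close> contracting, and \<open>B \<le> \<eta> P\<close> makes it map the strip to itself, because the
  term \<open>2\<pi>\<i>k\<close> does not affect the real part.
\<close>
lemma ex1_root: "\<exists>!w. w \<in> strip \<eta> \<and> of_nat P * w = p w + 2 * pi * \<i> * of_int k"
proof -
  let ?T = "\<lambda>w. (p w + 2 * pi * \<i> * of_int k) / of_nat P"
  have "\<exists>!w\<in>strip \<eta>. ?T w = w"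
  proof (rule Banach_fix)
    show "complete (strip \<eta>)"
      using closed_strip complete_eq_closed by blast
    show "strip \<eta> \<noteq> {}"
      using zero_in_strip by blast
    show "0 \<le> L / P" "L / P < 1"
      using L_nonneg large P_pos by auto
    show "?T ` strip \<eta> \<subseteq> strip \<eta>"
    proof safe
      fix w assume "w \<in> strip \<eta>"
      then have "\<bar>Re (p w)\<bar> \<le> \<eta> * P"
        using bound[of w] abs_Re_le_cmod[of "p w"] large by linarith
      then show "?T w \<in> strip \<eta>"
        using P_pos by (simp add: strip_def abs_divide field_simps)
    qed
    show "dist (?T v) (?T w) \<le> L / P * dist v w" if "v \<in> strip \<eta>" "w \<in> strip \<eta>" for v w
    proof -
      have "?T v - ?T w = (p v - p w) / of_nat P"
        by (simp add: diff_divide_distrib add_divide_distrib)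
      then have "dist (?T v) (?T w) = norm (p v - p w) / P"
        by (simp add: dist_norm norm_divide)
      then show ?thesis
        using lipschitz[OF that] P_pos by (simp add: dist_norm field_simps)
    qed
  qed
  moreover have "?T w = w \<longleftrightarrow> of_nat P * w = p w + 2 * pi * \<i> * of_int k" for w
    using P_pos by (auto simp: field_simps)
  ultimately show ?thesis by simp
qed

lemma root_in_strip: "root P k \<in> strip \<eta>"
  and root_eq: "of_nat P * root P k = p (root P k) + 2 * pi * \<i> * of_int k"
  using theI'[OF ex1_root[of k]] unfolding root_def by auto

lemma root_unique:
  "w \<in> strip \<eta> \<Longrightarrow> of_nat P * w = p w + 2 * pi * \<i> * of_int k \<Longrightarrow> w = root P k"
  using ex1_root[of k] root_in_strip[of k] root_eq[of k] by blast

lemma root_shift: "root P (k + j * int P) = root P k + 2 * pi * \<i> * of_int j"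
  by (rule root_unique[symmetric])
     (use root_in_strip[of k] root_eq[of k] periodic_int_shift[of \<eta> p, OF periodic root_in_strip[of k]]
      in \<open>auto simp: algebra_simps\<close>)

lemma root_near: "norm (root P k - 2 * pi * \<i> * of_int k / of_nat P) \<le> B / P"
proof -
  have "root P k - 2 * pi * \<i> * of_int k / of_nat P = p (root P k) / of_nat P"
    using root_eq[of k] P_pos by (simp add: field_simps)
  then show ?thesis
    using bound[OF root_in_strip[of k]] by (simp add: norm_divide divide_right_mono)
qed

lemma abs_Re_root_le: "\<bar>Re (root P k)\<bar> \<le> B / P"
  using abs_Re_le_cmod[of "root P k - 2 * pi * \<i> * of_int k / of_nat P"] root_near[of k]
  by simp

lemma inj_root: "inj (root P)"
proof (rule injI)
  fix k l assume eq: "root P k = root P l"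
  show "k = l"
    using root_eq[of k] root_eq[of l] unfolding eq by simp
qed

lemma fundamental_roots_eq: "fundamental_roots P = root P ` {k. 0 \<le> Im (root P k) \<and> Im (root P k) < 2 * pi}"
proof -
  have "exp (of_nat P * w) = exp (p w) \<longleftrightarrow> (\<exists>k. of_nat P * w = p w + 2 * pi * \<i> * of_int k)" for w
    unfolding exp_eq by (simp add: mult_ac)
  then show ?thesis
    using root_in_strip root_eq root_unique unfolding fundamental_roots_def image_def by blast
qed

lemma finite_fundamental_roots: "finite (fundamental_roots P)"
  and card_fundamental_roots: "card (fundamental_roots P) = P"
proof -
  have shift: "Im (root P (k + j * int P)) = Im (root P k) + 2 * pi * j" for k j
    by (simp add: root_shift)
  note * = card_period_window[of P "2 * pi" "\<lambda>k. Im (root P k)", OF P_pos _ shift]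
  show "finite (fundamental_roots P)" "card (fundamental_roots P) = P"
    unfolding fundamental_roots_eq using * inj_root
    by (auto simp: card_image inj_on_subset)
qed

lemma card_fundamental_roots_window:
  fixes a b :: real
  assumes "0 \<le> a" "a \<le> b" "b \<le> 2 * pi"
  shows "\<bar>real (card {w \<in> fundamental_roots P. a < Im w \<and> Im w < b}) - P * (b - a) / (2 * pi)\<bar>
           \<le> B / pi + 1"
proof -
  have near: "\<bar>Im (root P k) - 2 * pi * k / P\<bar> \<le> B / P" for k
    using abs_Im_le_cmod[of "root P k - 2 * pi * \<i> * of_int k / of_nat P"] root_near[of k]
    by simp
  have "{w \<in> fundamental_roots P. a < Im w \<and> Im w < b} =
          root P ` {k. a < Im (root P k) \<and> Im (root P k) < b}"
    using assms unfolding fundamental_roots_eq by auto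
  then have "card {w \<in> fundamental_roots P. a < Im w \<and> Im w < b} =
          card {k. a < Im (root P k) \<and> Im (root P k) < b}"
    using inj_root by (simp add: card_image inj_on_subset)
  then show ?thesis
    using card_window_of_perturbed_progression[of P a b "\<lambda>k. Im (root P k)", OF P_pos assms(2) near] by simp
qed

end

end

section \<open>A periodic logarithm near the unit circle\<close>

text \<open>
  The argument principle is applied on a disc slightly larger than the unit disc, whose zeros
  outside the unit circle have winding number 0.
\<close>
lemma argument_principle_unit_circle:
  assumes "open U" "connected U" "\<delta> > 0" "cball 0 (1 + \<delta>) \<subseteq> U" "f holomorphic_on U"
    and nz: "\<And>z. norm z = 1 \<Longrightarrow> f z \<noteq> 0"
  shows "contour_integral (circlepath 0 1) (\<lambda>z. deriv f z / f z) = 2 * pi * \<i> * of_nat (zeros_in_disc f)"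
proof -
  define S where "S = ball (0::complex) (1 + \<delta>)"
  define Z where "Z = {z \<in> S. f z = 0}"
  have "S \<subseteq> cball 0 (1 + \<delta>)"
    by (auto simp: S_def)
  then have SU: "S \<subseteq> U"
    using assms(4) by blast
  have holo: "f holomorphic_on S"
    using assms(5) SU by (rule holomorphic_on_subset)
  have S: "open S" "connected S" "1 \<in> S"
    using assms(3) by (auto simp: S_def)
  have non_zero: "\<exists>w\<in>S. f w \<noteq> 0"
    using S(3) nz[of 1] by auto
  have fin: "finite Z"
  proof (cases "f constant_on U")
    case True
    then obtain c where c: "\<And>z. z \<in> U \<Longrightarrow> f z = c"
      by (auto simp: constant_on_def)
    have "c \<noteq> 0"
      using c[of 1] S(3) SU nz[of 1] by auto
    then have "Z = {}"
      using c SU by (auto simp: Z_def)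
    then show ?thesis by simp
  next
    case False
    have "finite {z \<in> cball 0 (1 + \<delta>). f z = 0}"
      using assms False by (intro holomorphic_compact_finite_zeros[of f U]) auto
    then show ?thesis
      by (rule finite_subset[rotated]) (auto simp: Z_def S_def)
  qed
  have "contour_integral (circlepath 0 1) (\<lambda>z. deriv f z * 1 / f z) =
          2 * pi * \<i> * (\<Sum>p\<in>{w\<in>S. f w = 0 \<or> w \<in> {}}. winding_number (circlepath 0 1) p * 1 * zorder f p)"
  proof (rule argument_principle)
    show "path_image (circlepath 0 1) \<subseteq> S - {w \<in> S. f w = 0 \<or> w \<in> {}}"
      using nz assms(3) by (auto simp: S_def)
    show "\<forall>z. z \<notin> S \<longrightarrow> winding_number (circlepath 0 1) z = 0"
      using assms(3) by (auto simp: S_def intro!: winding_number_zero_outside[where s = "cball 0 1"])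
  qed (use S holo fin in \<open>auto simp: Z_def\<close>)
  also have "(\<Sum>p\<in>{w\<in>S. f w = 0 \<or> w \<in> {}}. winding_number (circlepath 0 1) p * 1 * zorder f p) =
               (\<Sum>p\<in>Z. winding_number (circlepath 0 1) p * zorder f p)"
    by (simp add: Z_def)
  also have "\<dots> = (\<Sum>p | norm p < 1 \<and> f p = 0. of_nat (nat (zorder f p)))"
  proof (rule sum.mono_neutral_cong_right)
    show "{p. norm p < 1 \<and> f p = 0} \<subseteq> Z"
      using assms(3) by (auto simp: Z_def S_def)
    show "\<forall>p\<in>Z - {p. norm p < 1 \<and> f p = 0}. winding_number (circlepath 0 1) p * zorder f p = 0"
    proof
      fix p assume "p \<in> Z - {p. norm p < 1 \<and> f p = 0}"
      then have "norm p > 1"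
        using nz[of p] by (force simp: Z_def)
      then show "winding_number (circlepath 0 1) p * zorder f p = 0"
        by (auto intro!: winding_number_zero_outside[where s = "cball 0 1"])
    qed
    fix p :: complex assume p: "p \<in> {p. norm p < 1 \<and> f p = 0}"
    then have "p \<in> S"
      using assms(3) by (auto simp: S_def)
    then have "zorder f p > 0"
      using zorder_exist_zero[OF holo S(1,2) _ non_zero] p by auto
    then show "winding_number (circlepath 0 1) p * zorder f p = of_nat (nat (zorder f p))"
      using p by (simp add: winding_number_circlepath)
  qed (fact fin)
  finally show ?thesis
    by (simp add: zeros_in_disc_def)
qed

lemma nonzero_strip:
  assumes "open U" "sphere 0 1 \<subseteq> U" "continuous_on U f"
    and nz: "\<And>z. norm z = 1 \<Longrightarrow> f z \<noteq> 0"
  shows "\<exists>\<eta>>0. \<forall>w::complex. \<bar>Re w\<bar> < \<eta> \<longrightarrow> exp w \<in> U \<and> f (exp w) \<noteq> (0::complex)"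
proof -
  define V where "V = U \<inter> f -` (- {0})"
  have "open V"
    unfolding V_def using assms by (intro continuous_open_preimage) auto
  moreover have "sphere 0 1 \<subseteq> V"
    using assms by (auto simp: V_def)
  ultimately obtain e where e: "e > 0" "(\<Union>x\<in>sphere 0 1. ball x e) \<subseteq> V"
    using compact_subset_open_imp_ball_epsilon_subset[of "sphere 0 1" V] by auto
  have "isCont exp (0::real)"
    by (intro continuous_intros)
  then obtain \<eta> where \<eta>: "\<eta> > 0" "\<And>t::real. \<bar>t\<bar> < \<eta> \<Longrightarrow> \<bar>exp t - 1\<bar> < e"
    using e(1) unfolding continuous_at_eps_delta by (auto simp: dist_real_def)
  have "exp w \<in> V" if "\<bar>Re w\<bar> < \<eta>" for w
  proof -
    have "exp w - cis (Im w) = of_real (exp (Re w) - 1) * cis (Im w)"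
      by (simp add: exp_eq_polar cis_conv_exp[symmetric] algebra_simps)
    then have "norm (exp w - cis (Im w)) = \<bar>exp (Re w) - 1\<bar>"
      by (simp only: norm_mult norm_of_real norm_cis mult_1_right)
    then have "dist (cis (Im w)) (exp w) = \<bar>exp (Re w) - 1\<bar>"
      by (simp only: dist_norm norm_minus_commute)
    also have "\<dots> < e"
      using \<eta>(2) that by blast
    finally have "exp w \<in> ball (cis (Im w)) e"
      by simp
    moreover have "cis (Im w) \<in> sphere 0 1"
      by simp
    ultimately show ?thesis
      using e(2) by blast
  qed
  then show ?thesis
    using \<eta>(1) by (intro exI[of _ \<eta>]) (auto simp: V_def)
qed

text \<open>
  The derivative of \<open>g\<close> is \<open>exp w * f' (exp w) / f (exp w)\<close>, which is periodic, so the increment of \<open>g\<close>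
  over a period is constant. Computed from \<open>0\<close> to \<open>2\<pi>\<i>\<close>, it is the integral of \<open>f' / f\<close> over the unit
  circle.
\<close>
lemma holomorphic_lift_increment:
  assumes "open U" "connected U" "\<delta> > 0" "cball 0 (1 + \<delta>) \<subseteq> U" "f holomorphic_on U"
    and nz: "\<And>z. norm z = 1 \<Longrightarrow> f z \<noteq> 0"
    and "\<eta> > 0"
    and g: "g holomorphic_on {w. \<bar>Re w\<bar> < \<eta>}"
    and fg: "\<And>w. \<bar>Re w\<bar> < \<eta> \<Longrightarrow> exp w \<in> U \<and> f (exp w) = exp (g w)"
  shows "\<And>w. \<bar>Re w\<bar> < \<eta> \<Longrightarrow> g (w + 2 * pi * \<i>) = g w + 2 * pi * \<i> * of_nat (zeros_in_disc f)"
proof -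
  define V where "V = {w. \<bar>Re w\<bar> < \<eta>}"
  have V: "open V" "convex V"
    unfolding V_def by (rule open_strip_topology)+
  have shift: "w + 2 * pi * \<i> \<in> V" if "w \<in> V" for w
    using that by (simp add: V_def)
  have dg: "(g has_field_derivative exp w * (deriv f (exp w) / f (exp w))) (at w)" if w: "w \<in> V" for w
  proof -
    have g': "(g has_field_derivative deriv g w) (at w)"
      using g V(1) w unfolding V_def by (rule holomorphic_derivI)
    have f': "(f has_field_derivative deriv f (exp w)) (at (exp w))"
      using assms(5,1) fg w unfolding V_def by (intro holomorphic_derivI) auto
    have "((\<lambda>w. exp (g w)) has_field_derivative exp (g w) * deriv g w) (at w)"
      using g' by (rule DERIV_fun_exp)
    moreover have "((\<lambda>w. exp (g w)) has_field_derivative deriv f (exp w) * exp w) (at w)"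
    proof (rule has_field_derivative_transform_within_open[OF _ V(1) w])
      show "((\<lambda>w. f (exp w)) has_field_derivative deriv f (exp w) * exp w) (at w)"
        using f' by (rule DERIV_chain2) (rule DERIV_exp)
    qed (use fg in \<open>auto simp: V_def\<close>)
    ultimately have "exp (g w) * deriv g w = deriv f (exp w) * exp w"
      by (rule DERIV_unique)
    then have "deriv g w = exp w * (deriv f (exp w) / f (exp w))"
      using fg[of w] w by (simp add: V_def field_simps)
    then show ?thesis
      using g' by simp
  qed
  have "(\<lambda>w. g (w + 2 * pi * \<i>) - g w) constant_on V"
  proof -
    have "((\<lambda>w. g (w + 2 * pi * \<i>) - g w) has_field_derivative 0) (at w within V)" if "w \<in> V" for w
    proof -
      have e: "exp (w + 2 * pi * \<i>) = exp w"
        by (simp add: exp_add)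
      have "((\<lambda>w. g (w + 2 * pi * \<i>)) has_field_derivative exp w * (deriv f (exp w) / f (exp w))) (at w)"
        using dg[OF shift[OF that]] unfolding e DERIV_shift .
      from DERIV_diff[OF this dg[OF that]] show ?thesis
        by (auto intro: has_field_derivative_at_within)
    qed
    from has_field_derivative_zero_constant[OF V(2) this] show ?thesis
      by (auto simp: constant_on_def)
  qed
  then obtain c where c: "\<And>w. w \<in> V \<Longrightarrow> g (w + 2 * pi * \<i>) - g w = c"
    by (auto simp: constant_on_def)
  define h where "h = (\<lambda>t. g (2 * pi * \<i> * of_real t))"
  have "(h has_vector_derivative 
           deriv f (circlepath 0 1 t) / f (circlepath 0 1 t) * vector_derivative (circlepath 0 1) (at t))
           (at t within {0..1})" for t
  proof -
    let ?w = "2 * pi * \<i> * of_real t"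
    have "?w \<in> V"
      using \<open>\<eta> > 0\<close> by (simp add: V_def)
    have "((\<lambda>z. g (2 * pi * \<i> * z)) has_field_derivative
            exp ?w * (deriv f (exp ?w) / f (exp ?w)) * (2 * pi * \<i>)) (at (of_real t))"
      by (rule DERIV_chain2[where g = "\<lambda>z. 2 * pi * \<i> * z", OF dg[OF \<open>?w \<in> V\<close>]])
         (auto intro!: derivative_eq_intros)
    from has_vector_derivative_real_field[OF this]
    have "(h has_vector_derivative exp ?w * (deriv f (exp ?w) / f (exp ?w)) * (2 * pi * \<i>)) (at t within {0..1})"
      unfolding h_def .
    moreover have "circlepath 0 1 t = exp ?w"
      by (simp add: circlepath mult_ac)
    moreover have "vector_derivative (circlepath 0 1) (at t) = 2 * pi * \<i> * exp ?w"
      by (simp add: vector_derivative_circlepath mult_ac)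
    ultimately show ?thesis
      by (simp only: mult_ac)
  qed
  then have "((\<lambda>t. deriv f (circlepath 0 1 t) / f (circlepath 0 1 t) * vector_derivative (circlepath 0 1) (at t))
          has_integral (h 1 - h 0)) {0..1}"
    by (intro fundamental_theorem_of_calculus) auto
  then have "contour_integral (circlepath 0 1) (\<lambda>z. deriv f z / f z) = h 1 - h 0"
    unfolding contour_integral_integral by (rule integral_unique)
  moreover have "h 1 - h 0 = c"
    using c[of 0] \<open>\<eta> > 0\<close> by (simp add: h_def V_def)
  ultimately have "c = 2 * pi * \<i> * of_nat (zeros_in_disc f)"
    using argument_principle_unit_circle[OF assms(1-6)] by simp
  then show "g (w + 2 * pi * \<i>) = g w + 2 * pi * \<i> * of_nat (zeros_in_disc f)" if "\<bar>Re w\<bar> < \<eta>" for w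
    using c[of w] that by (simp add: V_def algebra_simps)
qed

lemma periodic_logarithm:
  assumes "open U" "connected U" "\<delta> > 0" "cball 0 (1 + \<delta>) \<subseteq> U" "f holomorphic_on U"
    and nz: "\<And>z. norm z = 1 \<Longrightarrow> f z \<noteq> 0"
  obtains p \<eta> B L where "periodic_perturbation p \<eta> B L"
    and "\<And>w. w \<in> strip \<eta> \<Longrightarrow> exp w \<in> U \<and> f (exp w) = exp (of_nat (zeros_in_disc f) * w + p w)"
proof -
  let ?n = "of_nat (zeros_in_disc f) :: complex"
  have "sphere 0 1 \<subseteq> U"
    using assms(3,4) by (force simp: subset_iff)
  then obtain \<eta>' where \<eta>': "\<eta>' > 0" "\<And>w::complex. \<bar>Re w\<bar> < \<eta>' \<Longrightarrow> exp w \<in> U \<and> f (exp w) \<noteq> 0"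
    using nonzero_strip[of U f] assms holomorphic_on_imp_continuous_on by metis
  define V where "V = {w. \<bar>Re w\<bar> < \<eta>'}"
  have V: "open V" "convex V"
    unfolding V_def by (rule open_strip_topology)+
  have "(f \<circ> exp) holomorphic_on V"
    using \<eta>'(2) assms(5)
    by (intro holomorphic_on_compose_gen[where t = U] holomorphic_intros) (auto simp: V_def)
  then obtain g where g: "g holomorphic_on V" "\<And>w. w \<in> V \<Longrightarrow> (f \<circ> exp) w = exp (g w)"
    using contractible_imp_holomorphic_log[of "f \<circ> exp" V] \<eta>'(2) convex_imp_contractible[OF V(2)]
    by (auto simp: V_def)
  define p where "p = (\<lambda>w. g w - ?n * w)"
  define \<eta> where "\<eta> = \<eta>' / 2"
  have sub: "strip \<eta> \<subseteq> V"
    using \<eta>'(1) by (auto simp: strip_def V_def \<eta>_def)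
  have incr: "g (w + 2 * pi * \<i>) = g w + 2 * pi * \<i> * ?n" if "w \<in> V" for w
    using holomorphic_lift_increment[OF assms \<eta>'(1), of g] g \<eta>'(2) that by (auto simp: V_def)
  have per: "p (w + 2 * pi * \<i>) = p w" if "w \<in> V" for w
    using incr[OF that] by (simp add: p_def algebra_simps)
  have p: "p holomorphic_on V"
    unfolding p_def using g(1) by (intro holomorphic_intros)
  have p': "(p has_field_derivative deriv p w) (at w)" if "w \<in> V" for w
    using p V(1) that by (rule holomorphic_derivI)
  have per': "deriv p (w + 2 * pi * \<i>) = deriv p w" if "w \<in> V" for w
  proof -
    have "w + 2 * pi * \<i> \<in> V"
      using that by (simp add: V_def)
    from p'[OF this] have "((\<lambda>w. p (w + 2 * pi * \<i>)) has_field_derivative deriv p (w + 2 * pi * \<i>)) (at w)"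
      by (simp only: DERIV_shift)
    then have "(p has_field_derivative deriv p (w + 2 * pi * \<i>)) (at w)"
      by (rule has_field_derivative_transform_within_open[OF _ V(1) that per])
    then show ?thesis
      using p'[OF that] by (rule DERIV_unique)
  qed
  obtain B where B: "\<And>w. w \<in> strip \<eta> \<Longrightarrow> norm (p w) \<le> B"
    using periodic_continuous_bounded[of \<eta> p] per sub p
    by (meson continuous_on_subset holomorphic_on_imp_continuous_on subsetD)
  obtain L where L: "\<And>w. w \<in> strip \<eta> \<Longrightarrow> norm (deriv p w) \<le> L"
    using periodic_continuous_bounded[of \<eta> "deriv p"] per' sub holomorphic_deriv[OF p V(1)]
    by (meson continuous_on_subset holomorphic_on_imp_continuous_on subsetD)
  show ?thesis
  proof
    show "periodic_perturbation p \<eta> B L"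
    proof
      show "norm (p v - p w) \<le> L * norm (v - w)" if "v \<in> strip \<eta>" "w \<in> strip \<eta>" for v w
        using convex_strip _ L that
        by (rule field_differentiable_bound) (use p' sub in \<open>auto intro: has_field_derivative_at_within\<close>)
    qed (use \<eta>'(1) per sub B in \<open>auto simp: \<eta>_def\<close>)
    show "exp w \<in> U \<and> f (exp w) = exp (?n * w + p w)" if "w \<in> strip \<eta>" for w
      using that sub \<eta>'(2)[of w] g(2)[of w] by (auto simp: p_def V_def)
  qed
qed

section \<open>Exact and approximate solutions\<close>

text \<open>
  The roots of this function with \<open>P = N - n\<close> turn out to be purely imaginary, with the phases as
  imaginary parts.
\<close>
lemma (in periodic_perturbation) periodic_perturbation_imaginary_part:
  "periodic_perturbation (\<lambda>w. \<i> * of_real (Im (p (\<i> * of_real (Im w))))) \<eta> B L"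
proof
  have in_strip: "\<i> * of_real t \<in> strip \<eta>" for t :: real
    using \<eta>_pos by (simp add: strip_def)
  show "\<i> * of_real (Im (p (\<i> * of_real (Im (w + 2 * pi * \<i>))))) = \<i> * of_real (Im (p (\<i> * of_real (Im w))))" for w
    using periodic[OF in_strip[of "Im w"]] by (simp add: algebra_simps)
  show "norm (\<i> * of_real (Im (p (\<i> * of_real (Im w))))) \<le> B" for w
    using abs_Im_le_cmod[of "p (\<i> * of_real (Im w))"] bound[OF in_strip[of "Im w"]]
    by (simp add: norm_mult)
  show "norm (\<i> * of_real (Im (p (\<i> * of_real (Im v)))) - \<i> * of_real (Im (p (\<i> * of_real (Im w)))))
          \<le> L * norm (v - w)" for v w
  proof -
    have "\<i> * of_real (Im (p (\<i> * of_real (Im v)))) - \<i> * of_real (Im (p (\<i> * of_real (Im w)))) =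
            \<i> * of_real (Im (p (\<i> * of_real (Im v)) - p (\<i> * of_real (Im w))))"
      by (simp add: algebra_simps)
    then have "norm (\<i> * of_real (Im (p (\<i> * of_real (Im v)))) - \<i> * of_real (Im (p (\<i> * of_real (Im w))))) =
            \<bar>Im (p (\<i> * of_real (Im v)) - p (\<i> * of_real (Im w)))\<bar>"
      by (simp only: norm_mult norm_of_real norm_ii mult_1_left)
    also have "\<dots> \<le> L * norm (\<i> * of_real (Im v) - \<i> * of_real (Im w))"
      using abs_Im_le_cmod lipschitz[OF in_strip in_strip] by (rule order.trans)
    also have "norm (\<i> * of_real (Im v) - \<i> * of_real (Im w)) = \<bar>Im (v - w)\<bar>"
      by (simp add: norm_mult flip: right_diff_distrib of_real_diff)
    also have "L * \<dots> \<le> L * norm (v - w)"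
      using L_nonneg by (intro mult_left_mono abs_Im_le_cmod)
    finally show ?thesis .
  qed
qed (fact \<eta>_pos)

text \<open>
  Here \<open>p\<close> is the periodic part of a logarithm of \<open>f \<circ> exp\<close>.
\<close>
locale periodic_lift = periodic_perturbation +
  fixes U :: "complex set" and f :: "complex \<Rightarrow> complex" and n :: nat
  assumes lift: "\<And>w. w \<in> strip \<eta> \<Longrightarrow> exp w \<in> U \<and> f (exp w) = exp (of_nat n * w + p w)"
begin

lemma power_eq_iff:
  assumes "w \<in> strip \<eta>" "n \<le> N"
  shows "exp w ^ N = f (exp w) \<longleftrightarrow> exp (of_nat (N - n) * w) = exp (p w)"
proof -
  have "of_nat N * w = of_nat n * w + of_nat (N - n) * w"
    using assms(2) by (simp add: of_nat_diff algebra_simps)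
  then have "exp w ^ N = exp (of_nat n * w) * exp (of_nat (N - n) * w)"
    by (metis exp_of_nat_mult exp_add)
  moreover have "f (exp w) = exp (of_nat n * w) * exp (p w)"
    using lift[OF assms(1)] by (simp add: exp_add)
  ultimately show ?thesis
    by simp
qed

lemma eventually_large_diff:
  "\<forall>\<^sub>F N in sequentially. n < N \<and> L < real (N - n) \<and> B \<le> \<eta> * real (N - n)"
proof -
  have "\<forall>\<^sub>F N in sequentially. L < real (N - n) \<and> B \<le> \<eta> * real (N - n)"
    using eventually_compose_filterlim[OF eventually_large filterlim_minus_const_nat_at_top[of n]] .
  then show ?thesis
    using eventually_gt_at_top[of n] by eventually_elim auto
qed

text \<open>
  These are the modulus and the argument of \<open>f (cis s) = exp (n \<i>s + p(\<i>s))\<close>. The argument is compared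
  through \<open>cis\<close>, that is modulo \<open>2\<pi>\<close>, just as in the equation for the phases.
\<close>
lemma polar_form_on_lift:
  fixes s :: real
  assumes "polar_form f \<rho> \<phi>" "s \<in> {0..2*pi}"
  shows "\<rho> s = exp (Re (p (\<i> * s)))" "cis (\<phi> s) = cis (n * s + Im (p (\<i> * s)))"
proof -
  have "\<i> * s \<in> strip \<eta>"
    using \<eta>_pos by (simp add: strip_def)
  from lift[OF this] have "f (cis s) = exp (of_nat n * (\<i> * s) + p (\<i> * s))"
    by (simp add: cis_conv_exp)
  also have "\<dots> = of_real (exp (Re (p (\<i> * s)))) * cis (n * s + Im (p (\<i> * s)))"
    by (subst exp_eq_polar) (simp add: cis_conv_exp)
  finally have *: "of_real (\<rho> s) * cis (\<phi> s) = of_real (exp (Re (p (\<i> * s)))) * cis (n * s + Im (p (\<i> * s)))"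
    and pos: "\<rho> s > 0"
    using assms by (auto simp: polar_form_def)
  have "norm (of_real (\<rho> s) * cis (\<phi> s)) = norm (of_real (exp (Re (p (\<i> * s)))) * cis (n * s + Im (p (\<i> * s))))"
    unfolding * ..
  then show "\<rho> s = exp (Re (p (\<i> * s)))"
    using pos by (simp only: norm_mult norm_of_real norm_cis) simp
  with * show "cis (\<phi> s) = cis (n * s + Im (p (\<i> * s)))"
    by simp
qed

lemma mem_phase_set_iff:
  fixes s :: real
  assumes "polar_form f \<rho> \<phi>" "n \<le> N"
  shows "s \<in> phase_set \<phi> N \<longleftrightarrow>
           s \<in> {0..<2*pi} \<and> exp (of_nat (N - n) * (\<i> * s)) = exp (\<i> * of_real (Im (p (\<i> * s))))"
proof -
  have "[\<phi> s = real N * s] (rmod (2 * pi)) \<longleftrightarrow>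
          exp (of_nat (N - n) * (\<i> * s)) = exp (\<i> * of_real (Im (p (\<i> * s))))"
    if "s \<in> {0..<2*pi}"
  proof -
    have "[\<phi> s = real N * s] (rmod (2 * pi)) \<longleftrightarrow> cis (\<phi> s) = cis (N * s)"
      by (simp add: cis_eq_iff)
    also have "cis (\<phi> s) = cis (n * s) * cis (Im (p (\<i> * s)))"
      using polar_form_on_lift(2)[OF assms(1), of s] that by (simp add: cis_mult)
    also have "cis (N * s) = cis (n * s) * cis (real (N - n) * s)"
      using assms(2) by (simp add: cis_mult of_nat_diff algebra_simps)
    also have "cis (n * s) * cis (Im (p (\<i> * s))) = cis (n * s) * cis (real (N - n) * s) \<longleftrightarrow>
                 cis (real (N - n) * s) = cis (Im (p (\<i> * s)))"
      by auto
    finally show ?thesis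
      by (simp add: cis_conv_exp mult_ac)
  qed
  then show ?thesis
    by (auto simp: phase_set_def)
qed

lemma card_phase_set:
  assumes "polar_form f \<rho> \<phi>" "n \<le> N" "L < real (N - n)" "B \<le> \<eta> * real (N - n)"
  shows "finite (phase_set \<phi> N)" "card (phase_set \<phi> N) = N - n"
proof -
  define q where "q = (\<lambda>w. \<i> * of_real (Im (p (\<i> * of_real (Im w)))))"
  interpret q: periodic_perturbation q \<eta> B L
    unfolding q_def by (rule periodic_perturbation_imaginary_part)
  let ?R = "q.fundamental_roots (N - n)"
  have P: "N - n > 0"
    using assms(3) L_nonneg by (cases "N - n") auto
  \<comment> \<open>\<open>q\<close> takes imaginary values, so \<open>exp (q w)\<close> has modulus 1\<close>
  have Re_0: "Re w = 0" if "w \<in> ?R" for w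
  proof -
    have "norm (exp (of_nat (N - n) * w)) = norm (exp (q w))"
      using that by (simp add: q.fundamental_roots_def)
    then show ?thesis
      using P by (simp add: norm_exp_eq_Re q_def)
  qed
  have w_eq: "w = \<i> * of_real (Im w)" if "w \<in> ?R" for w
    using Re_0[OF that] by (simp add: complex_eq_iff)
  have "phase_set \<phi> N = Im ` ?R"
  proof (intro subset_antisym subsetI)
    fix s assume "s \<in> phase_set \<phi> N"
    then have "\<i> * of_real s \<in> ?R"
      using \<eta>_pos unfolding mem_phase_set_iff[OF assms(1,2)]
      unfolding q.fundamental_roots_def by (simp add: q_def strip_def)
    then show "s \<in> Im ` ?R"
      by (rule image_eqI[rotated]) simp
  next
    fix s assume "s \<in> Im ` ?R"
    then obtain w where w: "w \<in> ?R" "s = Im w"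
      by blast
    from w_eq[OF w(1)] have "w = \<i> * of_real s"
      by (simp add: w(2))
    with w(1) show "s \<in> phase_set \<phi> N"
      unfolding mem_phase_set_iff[OF assms(1,2)] q.fundamental_roots_def by (auto simp: q_def)
  qed
  moreover have "inj_on Im ?R"
    using w_eq by (metis inj_onI)
  ultimately show "finite (phase_set \<phi> N)" "card (phase_set \<phi> N) = N - n"
    using q.finite_fundamental_roots[OF assms(3,4)] q.card_fundamental_roots[OF assms(3,4)]
    by (simp_all add: card_image)
qed

text \<open>
  The root \<open>w\<close> satisfies \<open>N w = n w + p w + 2\<pi>\<i>k\<close>, and the point \<open>a\<close> to which it is compared
  satisfies \<open>N a = n \<i>s + p(\<i>s) + 2\<pi>\<i>k\<close> with the same \<open>k\<close>. Subtracting, \<open>N |w - a| \<le> (n + L) |w - \<i>s|\<close>, while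
  \<open>\<i>s\<close> is within \<open>B / N\<close> of \<open>a\<close>.
\<close>
lemma root_near_first_iterate:
  fixes s :: real
  assumes "n \<le> N" "L < real (N - n)" "B \<le> \<eta> * real (N - n)" and N: "2 * (real n + L) \<le> real N"
    and s: "exp (of_nat (N - n) * (\<i> * of_real s)) = exp (\<i> * of_real (Im (p (\<i> * s))))"
  shows "\<exists>w\<in>strip \<eta>. exp (of_nat (N - n) * w) = exp (p w) \<and>
           norm (w - (\<i> * s + of_real (Re (p (\<i> * s)) / N))) \<le> 2 * (n + L) * B / (real N)\<^sup>2"
proof -
  define a where "a = \<i> * s + of_real (Re (p (\<i> * s)) / N)"
  have P: "N - n > 0"
    using assms(2) L_nonneg by (cases "N - n") auto
  then have N_pos: "real N > 0"
    by simp
  have on_axis: "\<i> * s \<in> strip \<eta>"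
    using \<eta>_pos by (simp add: strip_def)
  obtain k :: int where k: "of_nat (N - n) * (\<i> * of_real s) = \<i> * of_real (Im (p (\<i> * s))) + 2 * pi * \<i> * of_int k"
    using s unfolding exp_eq by (auto simp: mult_ac)
  define w where "w = root (N - n) k"
  have w: "w \<in> strip \<eta>" "of_nat (N - n) * w = p w + 2 * pi * \<i> * of_int k"
    unfolding w_def using assms(2,3) by (rule root_in_strip, rule root_eq)
  have "of_nat N * a = of_nat N * (\<i> * s) + of_real (Re (p (\<i> * s)))"
    using N_pos by (simp add: a_def field_simps)
  also have "\<dots> = of_nat n * (\<i> * s) + (of_real (Re (p (\<i> * s))) + of_nat (N - n) * (\<i> * s))"
    using assms(1) by (simp add: of_nat_diff algebra_simps)
  also have "\<dots> = of_nat n * (\<i> * s) + (p (\<i> * s) + 2 * pi * \<i> * of_int k)"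
    unfolding k using complex_eq[of "p (\<i> * s)"] by simp
  finally have Na: "of_nat N * a = of_nat n * (\<i> * s) + (p (\<i> * s) + 2 * pi * \<i> * of_int k)" .
  have Nw: "of_nat N * w = of_nat n * w + (p w + 2 * pi * \<i> * of_int k)"
    using w(2) assms(1) by (simp add: of_nat_diff algebra_simps)
  have "of_nat N * (w - a) = of_nat n * (w - \<i> * s) + (p w - p (\<i> * s))"
    unfolding right_diff_distrib Na Nw by simp
  then have "N * norm (w - a) = norm (of_nat n * (w - \<i> * s) + (p w - p (\<i> * s)))"
    by (metis norm_mult norm_of_nat)
  also have "\<dots> \<le> n * norm (w - \<i> * s) + L * norm (w - \<i> * s)"
    using lipschitz[OF w(1) on_axis] by (intro norm_triangle_le add_mono) (auto simp: norm_mult)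
  also have "\<dots> = (n + L) * norm (w - \<i> * s)"
    by (simp add: algebra_simps)
  also have "\<dots> \<le> (n + L) * (norm (w - a) + B / N)"
  proof (intro mult_left_mono)
    have "norm (a - \<i> * s) = \<bar>Re (p (\<i> * s))\<bar> / N"
      by (simp add: a_def norm_divide)
    also have "\<dots> \<le> B / N"
      using abs_Re_le_cmod[of "p (\<i> * s)"] bound[OF on_axis] by (intro divide_right_mono) auto
    finally show "norm (w - \<i> * s) \<le> norm (w - a) + B / N"
      using norm_triangle_ineq[of "w - a" "a - \<i> * s"] by simp
  qed (use L_nonneg in auto)
  also have "\<dots> \<le> N / 2 * norm (w - a) + (n + L) * B / N"
    using mult_right_mono[OF N norm_ge_zero[of "w - a"]] by (simp add: algebra_simps)
  finally have "N * norm (w - a) \<le> 2 * ((n + L) * B / N)"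
    by simp
  then have "norm (w - a) \<le> 2 * (n + L) * B / (real N)\<^sup>2"
    using N_pos by (simp add: field_simps power2_eq_square)
  moreover have "exp (of_nat (N - n) * w) = exp (p w)"
    unfolding exp_eq w(2) by (intro exI[of _ k]) (simp add: mult_ac)
  ultimately show ?thesis
    using w(1) unfolding a_def by blast
qed

lemma exp_lipschitz_strip:
  assumes "v \<in> strip \<eta>" "w \<in> strip \<eta>"
  shows "norm (exp v - exp w) \<le> exp \<eta> * norm (v - w)"
  using convex_strip _ _ assms
  by (rule field_differentiable_bound)
     (auto simp: strip_def norm_exp_eq_Re intro: DERIV_exp has_field_derivative_at_within)

lemma solution_near_approx_sol:
  assumes polar: "polar_form f \<rho> \<phi>"
    and N: "n \<le> N" "L < real (N - n)" "B \<le> \<eta> * real (N - n)" "2 * (real n + L) \<le> real N"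
    and r: "r < N - n"
  shows "\<exists>z\<in>U. z ^ N = f z \<and> norm (z - approx_sol \<rho> \<phi> N r) \<le> exp \<eta> * (2 * (n + L) * B) / (real N)\<^sup>2"
proof -
  define s where "s = phase \<phi> N r"
  have P: "N - n > 0"
    using r by simp
  have "s \<in> phase_set \<phi> N"
    unfolding s_def phase_def using card_phase_set[OF polar N(1-3)] r
    by (metis nth_mem set_sorted_list_of_set length_sorted_list_of_set)
  then have s: "s \<in> {0..<2*pi}" "exp (of_nat (N - n) * (\<i> * of_real s)) = exp (\<i> * of_real (Im (p (\<i> * s))))"
    unfolding mem_phase_set_iff[OF polar N(1)] by auto
  define a where "a = \<i> * s + of_real (Re (p (\<i> * s)) / N)"
  obtain w where w: "w \<in> strip \<eta>" "exp (of_nat (N - n) * w) = exp (p w)"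
    "norm (w - a) \<le> 2 * (n + L) * B / (real N)\<^sup>2"
    using root_near_first_iterate[OF N s(2)] unfolding a_def by blast
  have a_strip: "a \<in> strip \<eta>"
  proof -
    have "\<i> * s \<in> strip \<eta>"
      using \<eta>_pos by (simp add: strip_def)
    then have "\<bar>Re (p (\<i> * s))\<bar> \<le> B"
      using abs_Re_le_cmod bound by (meson order.trans)
    also have "B \<le> \<eta> * real (N - n)"
      by (fact N(3))
    also have "\<dots> \<le> \<eta> * N"
      using \<eta>_pos by (intro mult_left_mono) auto
    finally show ?thesis
      using P by (simp add: a_def strip_def field_simps)
  qed
  have powr_eq: "\<rho> s powr (1 / N) = exp (Re (p (\<i> * s)) / N)"
    using polar_form_on_lift(1)[OF polar, of s] s(1) by (simp add: powr_def)
  then have "approx_sol \<rho> \<phi> N r = exp a"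
    unfolding approx_sol_def s_def[symmetric] a_def powr_eq
    by (simp only: exp_add cis_conv_exp exp_of_real mult.commute)
  moreover have "norm (exp w - exp a) \<le> exp \<eta> * (2 * (n + L) * B) / (real N)\<^sup>2"
    using exp_lipschitz_strip[OF w(1) a_strip] mult_left_mono[OF w(3), of "exp \<eta>"] by simp
  moreover have "exp w \<in> U" "exp w ^ N = f (exp w)"
    using lift[OF w(1)] power_eq_iff[OF w(1) N(1)] w(2) by auto
  ultimately show ?thesis
    by auto
qed

lemma eventually_solution_near_approx_sol:
  assumes polar: "polar_form f \<rho> \<phi>" and \<alpha>: "\<alpha> \<le> 2"
  shows "\<forall>\<^sub>F N in sequentially. \<forall>r<N - n. \<exists>z\<in>U. z ^ N = f z \<and>
           norm (z - approx_sol \<rho> \<phi> N r) \<le> exp \<eta> * (2 * (n + L) * B) * real N powr - \<alpha>"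
proof -
  have "\<forall>\<^sub>F N in sequentially. 2 * (real n + L) \<le> real N"
    using filterlim_real_sequentially unfolding filterlim_at_top by blast
  then show ?thesis
    using eventually_large_diff
  proof eventually_elim
    case (elim N)
    let ?C = "exp \<eta> * (2 * (n + L) * B)"
    have "1 / (real N)\<^sup>2 = real N powr - 2"
      using elim by (simp add: powr_minus_divide)
    also have "\<dots> \<le> real N powr - \<alpha>"
      using elim \<alpha> by (intro powr_mono) auto
    finally have "?C * (1 / (real N)\<^sup>2) \<le> ?C * real N powr - \<alpha>"
      using L_nonneg B_nonneg by (intro mult_left_mono) auto
    then have "?C / (real N)\<^sup>2 \<le> ?C * real N powr - \<alpha>"
      by simp
    then show ?case
      using solution_near_approx_sol[OF polar, of N] elim by (meson less_imp_le order.trans)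
  qed
qed

text \<open>
  The bound \<open>1 - exp (-\<eta>)\<close> on \<open>\<epsilon>\<close> puts the logarithm of every point of the annulus into the strip; the other
  two conditions put \<open>exp\<close> of every root into the annulus, since the roots have real part at most \<open>B / (N - n)\<close> in absolute
  value.
\<close>
lemma solutions_near_circle_eq:
  assumes N: "n \<le> N" "L < real (N - n)" "B \<le> \<eta> * real (N - n)"
    and \<epsilon>: "\<epsilon> \<le> 1 - exp (- \<eta>)" "exp (B / (N - n)) < 1 + \<epsilon>" "1 - \<epsilon> < exp (- (B / (N - n)))"
  shows "solutions_near_circle U f \<epsilon> N = exp ` fundamental_roots (N - n)"
proof (intro subset_antisym subsetI)
  fix z assume "z \<in> solutions_near_circle U f \<epsilon> N"
  then have z: "z ^ N = f z" "1 - \<epsilon> < norm z" "norm z < 1 + \<epsilon>"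
    by (auto simp: solutions_near_circle_def)
  have lower: "exp (- \<eta>) < norm z"
    using z(2) \<epsilon>(1) by simp
  then have pos: "norm z > 0"
    by (meson exp_gt_zero order.strict_trans)
  \<comment> \<open>\<open>1 + \<epsilon> \<le> 2 - exp (-\<eta>) \<le> exp \<eta>\<close>, by convexity of \<open>exp\<close>\<close>
  have upper: "norm z < exp \<eta>"
    using z(3) \<epsilon>(1) exp_ge_add_one_self[of \<eta>] exp_ge_add_one_self[of "-\<eta>"] by linarith
  define w where "w = Complex (ln (norm z)) (Arg2pi z)"
  have "z = exp w"
    using pos Arg2pi_eq[of z] by (simp add: w_def exp_eq_polar exp_of_real)
  moreover have "- \<eta> < ln (norm z)" "ln (norm z) < \<eta>"
    using lower upper pos by (metis exp_gt_zero ln_exp ln_less_cancel_iff)+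
  then have "w \<in> strip \<eta>"
    by (simp add: w_def strip_def)
  moreover have "0 \<le> Im w" "Im w < 2 * pi"
    using Arg2pi_ge_0 Arg2pi_lt_2pi by (auto simp: w_def)
  ultimately show "z \<in> exp ` fundamental_roots (N - n)"
    using power_eq_iff[OF _ N(1), of w] z(1) by (auto simp: fundamental_roots_def)
next
  fix z assume "z \<in> exp ` fundamental_roots (N - n)"
  then obtain w where w: "z = exp w" "w \<in> fundamental_roots (N - n)"
    by blast
  then have "\<bar>Re w\<bar> \<le> B / (N - n)"
    using fundamental_roots_eq[OF N(2,3)] abs_Re_root_le[OF N(2,3)] by auto
  then have "- (B / (N - n)) \<le> Re w" "Re w \<le> B / (N - n)"
    using abs_le_D1 abs_le_D2 minus_le_iff by blast+
  then have "exp (- (B / (N - n))) \<le> exp (Re w)" "exp (Re w) \<le> exp (B / (N - n))"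
    by (simp_all only: exp_le_cancel_iff)
  then have "1 - \<epsilon> < exp (Re w)" "exp (Re w) < 1 + \<epsilon>"
    using \<epsilon>(2,3) by (meson order.strict_trans1 order.strict_trans2)+
  then show "z \<in> solutions_near_circle U f \<epsilon> N"
    using w lift[of w] power_eq_iff[OF _ N(1), of w] \<epsilon>
    by (auto simp: solutions_near_circle_def fundamental_roots_def norm_exp_eq_Re)
qed

lemma inj_on_exp_fundamental_roots: "inj_on exp (fundamental_roots P)"
  by (rule inj_onI) (auto simp: fundamental_roots_def intro!: exp_complex_eqI)

lemma eventually_solutions_near_circle_eq:
  assumes \<epsilon>: "0 < \<epsilon>" "\<epsilon> \<le> 1 - exp (- \<eta>)"
  shows "\<forall>\<^sub>F N in sequentially. solutions_near_circle U f \<epsilon> N = exp ` fundamental_roots (N - n)"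
proof -
  have "(\<lambda>P. B / real P) \<longlonglongrightarrow> 0"
    by (rule lim_const_over_n)
  then have lim: "(\<lambda>N. B / real (N - n)) \<longlonglongrightarrow> 0"
    by (rule filterlim_compose[OF _ filterlim_minus_const_nat_at_top])
  have "(\<lambda>N. exp (B / real (N - n))) \<longlonglongrightarrow> exp 0" "(\<lambda>N. exp (- (B / real (N - n)))) \<longlonglongrightarrow> exp (- 0)"
    by (intro tendsto_intros lim)+
  then have "\<forall>\<^sub>F N in sequentially. exp (B / real (N - n)) < 1 + \<epsilon>"
    "\<forall>\<^sub>F N in sequentially. 1 - \<epsilon> < exp (- (B / real (N - n)))"
    using \<epsilon>(1) by (auto intro: order_tendstoD)
  then show ?thesis
    using eventually_large_diff
    by eventually_elim (rule solutions_near_circle_eq; use \<epsilon>(2) in auto)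
qed

lemma eventually_card_solutions_near_circle:
  assumes \<epsilon>: "0 < \<epsilon>" "\<epsilon> \<le> 1 - exp (- \<eta>)"
  shows "\<forall>\<^sub>F N in sequentially. finite (solutions_near_circle U f \<epsilon> N) \<and>
           card (solutions_near_circle U f \<epsilon> N) = N - n"
  using eventually_solutions_near_circle_eq[OF \<epsilon>] eventually_large_diff
proof eventually_elim
  case (elim N)
  then show ?case
    using finite_fundamental_roots[of "N - n"] card_fundamental_roots[of "N - n"]
    by (metis card_image finite_imageI inj_on_exp_fundamental_roots)
qed

lemma solutions_near_circle_equidistributed:
  assumes \<epsilon>: "0 < \<epsilon>" "\<epsilon> \<le> 1 - exp (- \<eta>)" and ab: "0 \<le> a" "a \<le> b" "b \<le> 2 * pi"
  shows "(\<lambda>N. real (card {z \<in> solutions_near_circle U f \<epsilon> N. a < Arg2pi z \<and> Arg2pi z < b})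
            / real (card (solutions_near_circle U f \<epsilon> N))) \<longlonglongrightarrow> (b - a) / (2 * pi)"
    (is "?ratio \<longlonglongrightarrow> ?l")
proof (rule LIM_zero_cancel, rule Lim_null_comparison)
  show "\<forall>\<^sub>F N in sequentially. norm (?ratio N - ?l) \<le> (B / pi + 1) / real (N - n)"
    using eventually_solutions_near_circle_eq[OF \<epsilon>] eventually_card_solutions_near_circle[OF \<epsilon>]
      eventually_large_diff
  proof eventually_elim
    case (elim N)
    let ?R = "fundamental_roots (N - n)"
    let ?c = "real (card {w \<in> ?R. a < Im w \<and> Im w < b})"
    have P: "real (N - n) > 0"
      using elim by simp
    have "{z \<in> exp ` ?R. a < Arg2pi z \<and> Arg2pi z < b} = exp ` {w \<in> ?R. a < Im w \<and> Im w < b}"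
      by (auto simp: fundamental_roots_def Arg2pi_exp)
    then have "card {z \<in> exp ` ?R. a < Arg2pi z \<and> Arg2pi z < b} = card {w \<in> ?R. a < Im w \<and> Im w < b}"
      by (auto intro!: card_image inj_on_subset[OF inj_on_exp_fundamental_roots])
    then have "?ratio N - ?l = (?c - real (N - n) * (b - a) / (2 * pi)) / real (N - n)"
      using elim P by (simp add: diff_divide_distrib)
    then have "norm (?ratio N - ?l) = \<bar>?c - real (N - n) * (b - a) / (2 * pi)\<bar> / real (N - n)"
      by simp
    also have "\<dots> \<le> (B / pi + 1) / real (N - n)"
      using elim ab by (intro divide_right_mono card_fundamental_roots_window) auto
    finally show ?case .
  qed
  show "(\<lambda>N. (B / pi + 1) / real (N - n)) \<longlonglongrightarrow> 0"
    by (rule filterlim_compose[OF lim_const_over_n filterlim_minus_const_nat_at_top])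
qed

end

theorem theorem13:
  fixes U :: "complex set" and f :: "complex \<Rightarrow> complex" and \<delta> :: real
    and \<rho> \<phi> :: "real \<Rightarrow> real" and n :: nat
  assumes "open U" and "connected U"
    and "\<delta> > 0" and "cball 0 (1 + \<delta>) \<subseteq> U"
    and "f holomorphic_on U" and "bounded (f ` U)"
    and "\<And>z. norm z = 1 \<Longrightarrow> f z \<noteq> 0"
    and "n = zeros_in_disc f"
    and "polar_form f \<rho> \<phi>"
  shows
    "(\<forall>\<^sub>F N in sequentially. n < N \<and> finite (phase_set \<phi> N) \<and> card (phase_set \<phi> N) = N - n) \<and>
     (\<forall>\<alpha>. 1 < \<alpha> \<and> \<alpha> < 2 \<longrightarrow>
        (\<exists>b :: real. \<forall>\<^sub>F N in sequentially. \<forall>r<N - n.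
           \<exists>z\<in>U. z ^ N = f z \<and> norm (z - approx_sol \<rho> \<phi> N r) \<le> b * real N powr - \<alpha>)) \<and>
     (\<exists>\<epsilon>\<^sub>0>0. \<forall>\<epsilon>. 0 < \<epsilon> \<and> \<epsilon> < \<epsilon>\<^sub>0 \<longrightarrow>
        (\<forall>\<^sub>F N in sequentially. finite (solutions_near_circle U f \<epsilon> N) \<and>
           card (solutions_near_circle U f \<epsilon> N) = N - n) \<and>
        (\<forall>\<theta>\<^sub>1 \<theta>\<^sub>2. 0 \<le> \<theta>\<^sub>1 \<and> \<theta>\<^sub>1 < \<theta>\<^sub>2 \<and> \<theta>\<^sub>2 \<le> 2 * pi \<longrightarrow>
           (\<lambda>N. real (card {z \<in> solutions_near_circle U f \<epsilon> N. \<theta>\<^sub>1 < Arg2pi z \<and> Arg2pi z < \<theta>\<^sub>2})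
                / real (card (solutions_near_circle U f \<epsilon> N)))
             \<longlonglongrightarrow> (\<theta>\<^sub>2 - \<theta>\<^sub>1) / (2 * pi)))"
proof -
  obtain p \<eta> B L where "periodic_perturbation p \<eta> B L"
    and lift: "\<And>w. w \<in> strip \<eta> \<Longrightarrow> exp w \<in> U \<and> f (exp w) = exp (of_nat n * w + p w)"
    using periodic_logarithm[OF assms(1-5,7)] assms(8) by metis
  then interpret periodic_lift p \<eta> B L U f n
    by (intro periodic_lift.intro periodic_lift_axioms.intro)
  have phases: "\<forall>\<^sub>F N in sequentially. n < N \<and> finite (phase_set \<phi> N) \<and> card (phase_set \<phi> N) = N - n"
    using eventually_large_diff
    by eventually_elim (use card_phase_set[OF assms(9)] in auto)
  have "\<exists>b :: real. \<forall>\<^sub>F N in sequentially. \<forall>r<N - n.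
           \<exists>z\<in>U. z ^ N = f z \<and> norm (z - approx_sol \<rho> \<phi> N r) \<le> b * real N powr - \<alpha>"
    if "1 < \<alpha> \<and> \<alpha> < 2" for \<alpha>
    using eventually_solution_near_approx_sol[OF assms(9), of \<alpha>] that by (intro exI) auto
  moreover have "1 - exp (- \<eta>) > 0"
    using \<eta>_pos by simp
  moreover have "(\<forall>\<^sub>F N in sequentially. finite (solutions_near_circle U f \<epsilon> N) \<and>
           card (solutions_near_circle U f \<epsilon> N) = N - n) \<and>
        (\<forall>\<theta>\<^sub>1 \<theta>\<^sub>2. 0 \<le> \<theta>\<^sub>1 \<and> \<theta>\<^sub>1 < \<theta>\<^sub>2 \<and> \<theta>\<^sub>2 \<le> 2 * pi \<longrightarrow>
           (\<lambda>N. real (card {z \<in> solutions_near_circle U f \<epsilon> N. \<theta>\<^sub>1 < Arg2pi z \<and> Arg2pi z < \<theta>\<^sub>2})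
                / real (card (solutions_near_circle U f \<epsilon> N)))
             \<longlonglongrightarrow> (\<theta>\<^sub>2 - \<theta>\<^sub>1) / (2 * pi))"
    if "0 < \<epsilon> \<and> \<epsilon> < 1 - exp (- \<eta>)" for \<epsilon>
    using that eventually_card_solutions_near_circle[of \<epsilon>] solutions_near_circle_equidistributed[of \<epsilon>]
    by simp
  ultimately show ?thesis
    using phases by blast
qed

end
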